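(* Let $P$ be a level poset with underlying digraph $G$ on the vertex set $V$, and let $<$ be a vertex shelling order on $V$. Let $[(u,i),(v,j)]$ be an interval of $P$ with $(u,i)<(v,j)$, and associate to each maximal chain $$(u,i)=(v_{i},i)\prec (v_{i+1},i+1)\prec \cdots \prec (v_{j-1},j-1)\prec (v_{j},j)=(v,j)$$ of this interval the word $v_{i}v_{i+1}\cdots v_{j}$. Then ordering the maximal chains of $[(u,i),(v,j)]$ by increasing lexicographic order (with respect to $<$) of the associated words is a shelling of the order complex $\Delta([(u,i),(v,j)])$.
   Context: Digraphs are finite and may have loops but no multiple edges. The level poset of a digraph $G$ on a finite nonempty vertex set $V$ is the poset on $V\times\mathbb{Z}$ with $(u,i)<(v,j)$ if and only if $i<j$ and there is a directed walk of length $j-i$ from $u$ to $v$ in $G$; $G$ is its underlying digraph. Here $\prec$ denotes the cover relation. Vertex shelling order: a linear order $<$ on the vertex set $V$ of a digraph $G$ such that for any $u,v\in V$ and every pair of walks $u=v_0\to v_1\to\cdots\to v_k=v$ and $u=v_0'\to v_1'\to\cdots\to v_k'=v$ of the same length with $v_1'<v_1$, there are a $j\in\{1,\dots,k-1\}$ and a vertex $w\in V$ such that $w<v_j$ and both $v_{j-1}\to w$ and $w\to v_{j+1}$ are edges of $G$. For a finite graded poset $Q$ with minimum $\hat 0$ and maximum $\hat 1$, the order complex $\Delta(Q)$ is the simplicial complex on the vertex set $Q\setminus\{\hat0,\hat1\}$ whose faces are the chains contained in $Q\setminus\{\hat 0,\hat 1\}$; its facets correspond to the maximal chains of $Q$ (by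 removing $\hat 0,\hat 1$). A shelling of a pure simplicial complex $\Delta$ is an ordering $F_1,\dots,F_t$ of its facets such that for every $k\in\{2,\dots,t\}$ the collection of faces of $F_k$ contained in some $F_i$ with $i<k$ is a pure simplicial complex of dimension $\dim(\Delta)-1$. *)

theory Defs
  imports "Graph_Theory.Graph_Theory"
begin

section \<open>Abstract simplicial complexes and shellings\<close>

definition simplicial_complex :: "'b set set \<Rightarrow> bool" where
  "simplicial_complex \<Delta> \<longleftrightarrow>
     finite \<Delta> \<and> \<Delta> \<noteq> {} \<and> (\<forall>F\<in>\<Delta>. finite F) \<and> (\<forall>F\<in>\<Delta>. \<forall>F'. F' \<subseteq> F \<longrightarrow> F' \<in> \<Delta>)"

definition facets :: "'b set set \<Rightarrow> 'b set set" where
  "facets \<Delta> = {F \<in> \<Delta>. \<forall>F'\<in>\<Delta>. F \<subseteq> F' \<longrightarrow> F' = F}"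

(* The empty face has dimension -1, so dimensions are integers. *)
definition face_dim :: "'b set \<Rightarrow> int" where
  "face_dim F = int (card F) - 1"

definition complex_dim :: "'b set set \<Rightarrow> int" where
  "complex_dim \<Delta> = Max (face_dim ` \<Delta>)"

definition pure_complex :: "'b set set \<Rightarrow> bool" where
  "pure_complex \<Delta> \<longleftrightarrow>
     simplicial_complex \<Delta> \<and> (\<forall>F\<in>facets \<Delta>. face_dim F = complex_dim \<Delta>)"

(* Positions in Fs are counted from 0, so "every facet but the first" reads 1 \<le> k. *)
definition shelling :: "'b set set \<Rightarrow> 'b set list \<Rightarrow> bool" where
  "shelling \<Delta> Fs \<longleftrightarrow>
     pure_complex \<Delta> \<and> distinct Fs \<and> set Fs = facets \<Delta> \<and>
     (\<forall>k. 1 \<le> k \<and> k < length Fs \<longrightarrow>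
        (let \<Gamma> = {F. F \<subseteq> Fs ! k \<and> (\<exists>i<k. F \<subseteq> Fs ! i)}
         in pure_complex \<Gamma> \<and> complex_dim \<Gamma> = complex_dim \<Delta> - 1))"


section \<open>Posets given by a carrier and a strict order\<close>

definition interval :: "('b \<Rightarrow> 'b \<Rightarrow> bool) \<Rightarrow> 'b \<Rightarrow> 'b \<Rightarrow> 'b set" where
  "interval lt a b = {x. (x = a \<or> lt a x) \<and> (x = b \<or> lt x b)}"

definition maximal_chains :: "'b set \<Rightarrow> ('b \<Rightarrow> 'b \<Rightarrow> bool) \<Rightarrow> 'b set set" where
  "maximal_chains Q lt = {C. pred_on.maxchain Q lt C}"

(* b0 and b1 are the minimum and the maximum of Q. *)
definition order_complex :: "'b set \<Rightarrow> ('b \<Rightarrow> 'b \<Rightarrow> bool) \<Rightarrow> 'b \<Rightarrow> 'b \<Rightarrow> 'b set set" where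
  "order_complex Q lt b0 b1 = {C. pred_on.chain (Q - {b0, b1}) lt C}"


section \<open>Level posets and vertex shelling orders\<close>

definition level_less :: "('a, 'b) pre_digraph \<Rightarrow> 'a \<times> int \<Rightarrow> 'a \<times> int \<Rightarrow> bool" where
  "level_less G x y \<longleftrightarrow>
     snd x < snd y \<and>
     (\<exists>p. vwalk p G \<and> hd p = fst x \<and> last p = fst y \<and> int (vwalk_length p) = snd y - snd x)"

(* The strict order < on the vertices is the relation lt. Walks of length 0 are excluded,
   since they have no vertex v_1 to compare. *)
definition vertex_shelling_order :: "('a, 'b) pre_digraph \<Rightarrow> 'a rel \<Rightarrow> bool" where
  "vertex_shelling_order G lt \<longleftrightarrow>
     lt \<subseteq> verts G \<times> verts G \<and> strict_linear_order_on (verts G) lt \<and>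
     (\<forall>p p' k. vwalk p G \<and> vwalk p' G \<and> hd p = hd p' \<and> last p = last p' \<and>
        vwalk_length p = k \<and> vwalk_length p' = k \<and> 1 \<le> k \<and> (p' ! 1, p ! 1) \<in> lt \<longrightarrow>
        (\<exists>j w. 1 \<le> j \<and> j \<le> k - 1 \<and> w \<in> verts G \<and> (w, p ! j) \<in> lt \<and>
           p ! (j - 1) \<rightarrow>\<^bsub>G\<^esub> w \<and> w \<rightarrow>\<^bsub>G\<^esub> p ! (j + 1)))"

(* A maximal chain of an interval from level i to level j has exactly one element on each
   level in between; the word lists their vertices. *)
definition chain_word :: "int \<Rightarrow> int \<Rightarrow> ('a \<times> int) set \<Rightarrow> 'a list" where
  "chain_word i j C = map (\<lambda>l. THE x. (x, l) \<in> C) [i..j]"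

definition lex_ordering ::
  "'a rel \<Rightarrow> int \<Rightarrow> int \<Rightarrow> ('a \<times> int) set set \<Rightarrow> ('a \<times> int) set list \<Rightarrow> bool" where
  "lex_ordering lt i j M Cs \<longleftrightarrow>
     set Cs = M \<and> sorted_wrt (\<lambda>C D. (chain_word i j C, chain_word i j D) \<in> lexord lt) Cs"

end

theory Submission
  imports Defs
begin

text \<open>Maximal chains of the interval are the walks of length \<open>j - i\<close> from \<open>u\<close> to \<open>v\<close>. If the walk
  \<open>p'\<close> precedes \<open>p\<close> lexicographically, the vertex shelling order lets one replace a single vertex
  of \<open>p\<close>, on a level where \<open>p\<close> and \<open>p'\<close> differ, by a smaller one. The resulting chain precedes
  that of \<open>p\<close>, differs from it in one element, and contains its intersection with that of \<open>p'\<close>;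
  this exchange property makes the order a shelling.\<close>

section \<open>Sorted enumerations\<close>

text \<open>Yields existence and uniqueness of the lexicographic listing. The order axioms are asked
  only on \<open>M\<close>, because totality of the lexicographic order is available only for words
  over the vertex set.\<close>

lemma ex1_sorted_wrt_enumeration:
  assumes "finite M"
    and trans: "\<And>x y z. x \<in> M \<Longrightarrow> y \<in> M \<Longrightarrow> z \<in> M \<Longrightarrow> R x y \<Longrightarrow> R y z \<Longrightarrow> R x z"
    and irrefl: "\<And>x. x \<in> M \<Longrightarrow> \<not> R x x"
    and total: "\<And>x y. x \<in> M \<Longrightarrow> y \<in> M \<Longrightarrow> x \<noteq> y \<Longrightarrow> R x y \<or> R y x"
  shows "\<exists>!xs. set xs = M \<and> sorted_wrt R xs"
proof (rule ex_ex1I)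
  show "\<exists>xs. set xs = M \<and> sorted_wrt R xs"
    using assms
  proof (induction M rule: finite_induct)
    case empty
    then show ?case by simp
  next
    case (insert x M)
    have "\<exists>xs. set xs = M \<and> sorted_wrt R xs"
      using insert.prems by (intro insert.IH) (blast+)
    then obtain xs where xs: "set xs = M" "sorted_wrt R xs" by blast
    \<comment> \<open>Totality sends every entry of \<open>xs\<close> to one side of
      \<open>x\<close>, and transitivity through \<open>x\<close> orders the two sides.\<close>
    let ?ys = "filter (\<lambda>y. R y x) xs @ x # filter (\<lambda>y. R x y) xs"
    have "set ?ys = insert x M"
      using xs(1) insert.hyps insert.prems(3)[of x] by auto
    moreover have "sorted_wrt R ?ys"
      using xs by (auto simp: sorted_wrt_append sorted_wrt_filter intro: insert.prems(1)[of _ x])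
    ultimately show ?case by blast
  qed
next
  fix xs ys
  assume "set xs = M \<and> sorted_wrt R xs" "set ys = M \<and> sorted_wrt R ys"
  then have "set ys = set xs" "sorted_wrt R xs" "sorted_wrt R ys" "set xs \<subseteq> M" by auto
  then show "xs = ys"
  proof (induction xs arbitrary: ys)
    case Nil
    then show ?case by simp
  next
    case (Cons x xs)
    then obtain y ys' where ys: "ys = y # ys'" by (cases ys) auto
    have eq: "insert y (set ys') = insert x (set xs)"
      and R: "\<And>z. z \<in> set xs \<Longrightarrow> R x z" "\<And>z. z \<in> set ys' \<Longrightarrow> R y z"
      using Cons.prems ys by auto
    have xM: "x \<in> M" and yM: "y \<in> M" using eq Cons.prems(4) by auto
    have "x = y"
    proof (rule ccontr)
      \<comment> \<open>Each head would occur in the other tail, which gives both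
        \<open>R x y\<close> and \<open>R y x\<close>.\<close>
      assume "x \<noteq> y"
      then have "y \<in> set xs" "x \<in> set ys'" using eq by auto
      then have "R x x" using R trans[of x y x] xM yM by blast
      then show False using irrefl xM by blast
    qed
    moreover have "x \<notin> set xs" "y \<notin> set ys'"
      using R irrefl xM yM by blast+
    ultimately have "set ys' = set xs"
      using eq by (simp add: insert_ident)
    then have "xs = ys'"
      using Cons.prems ys by (intro Cons.IH) auto
    then show ?case using ys \<open>x = y\<close> by simp
  qed
qed

text \<open>\<open>lex_ordering\<close> prescribes only the set of entries and their order; the
  absence of repetitions, which \<open>shelling\<close> demands, comes from irreflexivity.\<close>

lemma sorted_wrt_irrefl_distinct:
  assumes "sorted_wrt R xs" "\<And>x. x \<in> set xs \<Longrightarrow> \<not> R x x"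
  shows "distinct xs"
  using assms by (induction xs) auto

text \<open>The first position where the two words differ decides, and its two letters lie in
  \<open>V\<close>, where \<open>r\<close> is total.\<close>

lemma lexord_total_on_eq_length:
  assumes "length xs = length ys" "total_on V r" "set xs \<subseteq> V" "set ys \<subseteq> V" "xs \<noteq> ys"
  shows "(xs, ys) \<in> lexord r \<or> (ys, xs) \<in> lexord r"
  using assms by (induction xs ys rule: list_induct2) (auto simp: total_on_def)


section \<open>A shelling criterion\<close>

text \<open>By the exchange property, a face that \<open>Fs ! k\<close> shares with an earlier
  \<open>Fs ! h\<close> avoids some \<open>x\<close>, hence lies in \<open>Fs ! k - {x}\<close>,
  which is itself contained in an earlier facet. So the shared faces form a complex generated by
  sets of size \<open>d - 1\<close>.\<close>

lemma shellingI_exchange: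
  assumes \<Delta>: "\<Delta> = {F. \<exists>E\<in>set Fs. F \<subseteq> E}"
    and "Fs \<noteq> []" "distinct Fs"
    and finite: "\<And>E. E \<in> set Fs \<Longrightarrow> finite E"
    and card: "\<And>E. E \<in> set Fs \<Longrightarrow> card E = d"
    and exchange: "\<And>h k. h < k \<Longrightarrow> k < length Fs \<Longrightarrow>
      \<exists>l<k. \<exists>x\<in>Fs ! k. Fs ! k - {x} \<subseteq> Fs ! l \<and> x \<notin> Fs ! h"
  shows "shelling \<Delta> Fs"
proof -
  \<comment> \<open>A complex generated by sets of one size is pure, since its facets are among the
    generators. This is used for \<Delta> with \<open>c = d\<close> and for the shared faces with
    \<open>c = d - 1\<close>.\<close>
  have pureI: "pure_complex (\<Union>(Pow ` S)) \<and> complex_dim (\<Union>(Pow ` S)) = int c - 1"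
    if S: "finite S" "S \<noteq> {}" "\<And>E. E \<in> S \<Longrightarrow> finite E \<and> card E = c" for S :: "'a set set" and c
  proof -
    let ?\<Gamma> = "\<Union>(Pow ` S)"
    have sc: "simplicial_complex ?\<Gamma>"
      using S by (auto simp: simplicial_complex_def intro: finite_subset)
    then have fin: "finite (face_dim ` ?\<Gamma>)" by (simp add: simplicial_complex_def)
    obtain E where E: "E \<in> S" using S(2) by blast
    have "Max (face_dim ` ?\<Gamma>) = int c - 1"
    proof (rule Max_eqI[OF fin])
      fix y assume "y \<in> face_dim ` ?\<Gamma>"
      then obtain F E' where "y = face_dim F" "F \<subseteq> E'" "E' \<in> S" by auto
      then show "y \<le> int c - 1"
        using S(3)[of E'] card_mono[of E' F] by (simp add: face_dim_def)
    next
      have "face_dim E = int c - 1" using S(3)[OF E] by (simp add: face_dim_def)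
      then show "int c - 1 \<in> face_dim ` ?\<Gamma>" using E by (metis PowI UN_I image_eqI subset_refl)
    qed
    then have dim: "complex_dim ?\<Gamma> = int c - 1" by (simp add: complex_dim_def)
    have "facets ?\<Gamma> \<subseteq> S" unfolding facets_def by blast
    then have "face_dim F = int c - 1" if "F \<in> facets ?\<Gamma>" for F
      using that S(3) by (auto simp: face_dim_def)
    then show ?thesis using sc dim by (simp add: pure_complex_def)
  qed
  have \<Delta>': "\<Delta> = \<Union>(Pow ` set Fs)" unfolding \<Delta> by auto
  have pure: "pure_complex \<Delta>" and dim: "complex_dim \<Delta> = int d - 1"
    using pureI[of "set Fs" d] \<open>Fs \<noteq> []\<close> finite card unfolding \<Delta>' by auto
  have "set Fs \<subseteq> facets \<Delta>"
  proof
    fix E assume E: "E \<in> set Fs"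
    \<comment> \<open>All generators have \<open>d\<close> elements, so none contains another
      properly.\<close>
    have "F = E" if "F \<in> \<Delta>" "E \<subseteq> F" for F
    proof -
      obtain E' where E': "E' \<in> set Fs" "F \<subseteq> E'" using \<open>F \<in> \<Delta>\<close> \<Delta> by blast
      then have "E = E'"
        using card_subset_eq[of E' E] finite card E \<open>E \<subseteq> F\<close> by auto
      then show ?thesis using E' \<open>E \<subseteq> F\<close> by blast
    qed
    then show "E \<in> facets \<Delta>" using E unfolding facets_def \<Delta> by blast
  qed
  moreover have "facets \<Delta> \<subseteq> set Fs" unfolding facets_def \<Delta> by blast
  ultimately have facets: "set Fs = facets \<Delta>" by blast
  have step: "pure_complex \<Gamma> \<and> complex_dim \<Gamma> = complex_dim \<Delta> - 1"
    if k: "1 \<le> k" "k < length Fs" and \<Gamma>: "\<Gamma> = {F. F \<subseteq> Fs ! k \<and> (\<exists>h<k. F \<subseteq> Fs ! h)}" for k \<Gamma>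
  proof -
    \<comment> \<open>The generators: codimension-one faces of \<open>Fs ! k\<close> that already
      occur in an earlier facet.\<close>
    define S where "S = {Fs ! k - {x} | x. x \<in> Fs ! k \<and> (\<exists>l<k. Fs ! k - {x} \<subseteq> Fs ! l)}"
    have Fk: "finite (Fs ! k)" "card (Fs ! k) = d" using finite card k by auto
    have "finite S" by (rule finite_subset[of S "Pow (Fs ! k)"]) (use Fk in \<open>auto simp: S_def\<close>)
    moreover have "S \<noteq> {}" using exchange[of 0 k] k unfolding S_def by auto
    moreover have "finite E \<and> card E = d - 1" if "E \<in> S" for E
      using that Fk unfolding S_def by auto
    ultimately have P: "pure_complex (\<Union>(Pow ` S)) \<and> complex_dim (\<Union>(Pow ` S)) = int (d - 1) - 1"
      by (rule pureI)
    have "\<Gamma> = \<Union>(Pow ` S)"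
    proof
      show "\<Gamma> \<subseteq> \<Union>(Pow ` S)"
      proof
        fix F assume "F \<in> \<Gamma>"
        then obtain h where h: "F \<subseteq> Fs ! k" "h < k" "F \<subseteq> Fs ! h" using \<Gamma> by blast
        then obtain l x where "l < k" "x \<in> Fs ! k" "Fs ! k - {x} \<subseteq> Fs ! l" "x \<notin> Fs ! h"
          using exchange[of h k] k by blast
        then show "F \<in> \<Union>(Pow ` S)" using h unfolding S_def by blast
      qed
      show "\<Union>(Pow ` S) \<subseteq> \<Gamma>" unfolding \<Gamma> S_def by blast
    qed
    \<comment> \<open>The facet \<open>Fs ! k\<close> contains the exchanged element, so the
      subtraction \<open>d - 1\<close> on naturals is not truncated.\<close>
    moreover have "d > 0"
      using exchange[of 0 k] k Fk by (auto simp: card_gt_0_iff)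
    ultimately show ?thesis using P dim by (simp add: of_nat_diff)
  qed
  show ?thesis
    unfolding shelling_def Let_def using pure \<open>distinct Fs\<close> facets step by auto
qed


section \<open>Walks of a given length\<close>

lemma vwalk_iff_nth:
  "vwalk p G \<longleftrightarrow>
    p \<noteq> [] \<and> set p \<subseteq> verts G \<and> (\<forall>k. Suc k < length p \<longrightarrow> p ! k \<rightarrow>\<^bsub>G\<^esub> p ! Suc k)"
proof -
  have "set (vwalk_arcs p) \<subseteq> arcs_ends G \<longleftrightarrow> (\<forall>k. Suc k < length p \<longrightarrow> p ! k \<rightarrow>\<^bsub>G\<^esub> p ! Suc k)"
    by (induction p rule: vwalk_arcs.induct) (auto simp: less_Suc_eq_0_disj)
  then show ?thesis by (auto simp: vwalk_def)
qed

text \<open>Here \<open>n\<close> counts arcs, whence \<open>Suc n\<close> vertices. The ends are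
  given by position to suit cutting, gluing and updating; \<open>walks_hd_last\<close> links back to
  the \<open>hd\<close> and \<open>last\<close> of the given definitions.\<close>

definition walks :: "('a, 'b) pre_digraph \<Rightarrow> 'a \<Rightarrow> 'a \<Rightarrow> nat \<Rightarrow> 'a list set" where
  "walks G u v n = {p. vwalk p G \<and> p ! 0 = u \<and> p ! n = v \<and> length p = Suc n}"

text \<open>Turns a word into the chain that starts on level \<open>i\<close>;
  \<open>chain_word\<close> is its inverse on words of a fixed positive length.\<close>

definition level_set :: "int \<Rightarrow> 'a list \<Rightarrow> ('a \<times> int) set" where
  "level_set i p = {(p ! k, i + int k) | k. k < length p}"

lemma walks_hd_last:
  "walks G u v n = {p. vwalk p G \<and> hd p = u \<and> last p = v \<and> length p = Suc n}"
  by (force simp: walks_def hd_conv_nth last_conv_nth)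

lemma walks_length: "p \<in> walks G u v n \<Longrightarrow> length p = Suc n"
  by (simp add: walks_def)

lemma walks_nth: "p \<in> walks G u v n \<Longrightarrow> p ! 0 = u \<and> p ! n = v"
  by (simp add: walks_def)

lemma level_less_iff_walks:
  "level_less G (u, i) (v, j) \<longleftrightarrow> (\<exists>n>0. j = i + int n \<and> walks G u v n \<noteq> {})"
proof
  assume "level_less G (u, i) (v, j)"
  then obtain p where "i < j" and p: "vwalk p G" "hd p = u" "last p = v" "int (length p - 1) = j - i"
    by (auto simp: level_less_def)
  moreover have "p \<noteq> []" using p(1) by (simp add: vwalk_def)
  ultimately have "p \<in> walks G u v (length p - 1)" by (simp add: walks_hd_last)
  moreover have "j = i + int (length p - 1)" "length p - 1 > 0" using p(4) \<open>i < j\<close> by linarith+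
  ultimately show "\<exists>n>0. j = i + int n \<and> walks G u v n \<noteq> {}" by blast
qed (auto simp: level_less_def walks_hd_last)

lemma walks_take_drop:
  assumes "p \<in> walks G u v n" "a \<le> b" "b \<le> n"
  shows "take (Suc (b - a)) (drop a p) \<in> walks G (p ! a) (p ! b) (b - a)"
proof -
  have "set (take (Suc (b - a)) (drop a p)) \<subseteq> set p"
    by (meson order_trans set_drop_subset set_take_subset)
  then show ?thesis
    using assms unfolding walks_def vwalk_iff_nth by auto
qed

lemma walks_append:
  assumes "p \<in> walks G u v n" "q \<in> walks G v w m"
  shows "p @ tl q \<in> walks G u w (n + m)"
    and "level_set i (p @ tl q) = level_set i p \<union> level_set (i + int n) q"
proof -
  let ?r = "p @ tl q"
  have left: "?r ! k = p ! k" if "k \<le> n" for k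
    using assms that by (auto simp: walks_def nth_append)
  \<comment> \<open>The case \<open>k = 0\<close> is the junction: position \<open>n\<close> holds
    the common vertex \<open>v\<close>, which \<open>tl\<close> removes from
    \<open>q\<close>.\<close>
  have right: "?r ! (n + k) = q ! k" if "k \<le> m" for k
    using assms that by (cases k) (auto simp: walks_def nth_append nth_tl)
  have len: "length ?r = Suc (n + m)" using assms by (simp add: walks_def)
  have "?r ! k \<rightarrow>\<^bsub>G\<^esub> ?r ! Suc k" if "Suc k < length ?r" for k
  proof (cases "k < n")
    case True
    then show ?thesis using left[of k] left[of "Suc k"] assms by (auto simp: walks_def vwalk_iff_nth)
  next
    case False
    then obtain k' where k': "k = n + k'" by (metis le_iff_add not_less)
    then show ?thesis
      using right[of k'] right[of "Suc k'"] assms that len by (auto simp: walks_def vwalk_iff_nth)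
  qed
  moreover have "set ?r \<subseteq> verts G"
    using assms by (cases q) (auto simp: walks_def vwalk_def)
  moreover have "?r \<noteq> []" using assms(1) by (simp add: walks_def vwalk_def)
  ultimately show "?r \<in> walks G u w (n + m)"
    using left[of 0] right[of m] len assms by (simp add: walks_def vwalk_iff_nth)
  show "level_set i ?r = level_set i p \<union> level_set (i + int n) q"
  proof
    show "level_set i ?r \<subseteq> level_set i p \<union> level_set (i + int n) q"
    proof
      fix x assume "x \<in> level_set i ?r"
      then obtain k where k: "k \<le> n + m" "x = (?r ! k, i + int k)" using len by (auto simp: level_set_def)
      show "x \<in> level_set i p \<union> level_set (i + int n) q"
      proof (cases "k \<le> n")
        case True
        then show ?thesis using k left[of k] assms by (auto simp: level_set_def walks_def)
      next
        case False
        then obtain k' where k': "k = n + k'" by (metis le_iff_add nat_le_linear)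
        then have "x = (q ! k', (i + int n) + int k')" "k' < length q"
          using k right[of k'] assms by (auto simp: walks_def)
        then show ?thesis by (auto simp: level_set_def)
      qed
    qed
    have "(p ! k, i + int k) \<in> level_set i ?r" if "k < length p" for k
      using that left[of k] len assms unfolding level_set_def
      by (intro CollectI exI[of _ k]) (auto simp: walks_def)
    moreover have "(q ! k, i + int n + int k) \<in> level_set i ?r" if "k < length q" for k
      using that right[of k] len assms unfolding level_set_def
      by (intro CollectI exI[of _ "n + k"]) (auto simp: walks_def)
    ultimately show "level_set i p \<union> level_set (i + int n) q \<subseteq> level_set i ?r"
      by (auto simp: level_set_def[of i p] level_set_def[of "i + int n" q])
  qed
qed

lemma level_less_nth:
  assumes "p \<in> walks G u v n" "a < b" "b \<le> n"
  shows "level_less G (p ! a, i + int a) (p ! b, i + int b)"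
  unfolding level_less_iff_walks
  using walks_take_drop[OF assms(1), of a b] assms by (intro exI[of _ "b - a"]) auto

lemma walks_list_update:
  assumes p: "p \<in> walks G u v n" and m: "0 < m" "m < n"
    and w: "w \<in> verts G" "p ! (m - 1) \<rightarrow>\<^bsub>G\<^esub> w" "w \<rightarrow>\<^bsub>G\<^esub> p ! Suc m"
  shows "p[m := w] \<in> walks G u v n"
proof -
  have "p[m := w] ! k \<rightarrow>\<^bsub>G\<^esub> p[m := w] ! Suc k" if "Suc k < length p" for k
    using p m w that by (auto simp: walks_def vwalk_iff_nth nth_list_update)
  then show ?thesis
    using p m w set_update_subset_insert[of p m w] by (auto simp: walks_def vwalk_iff_nth)
qed

lemma mem_level_set_iff: "(x, i + int k) \<in> level_set i p \<longleftrightarrow> k < length p \<and> x = p ! k"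
  by (auto simp: level_set_def)

lemma level_set_walk_ends:
  assumes "p \<in> walks G u v n"
  shows "(u, i) \<in> level_set i p" "(v, i + int n) \<in> level_set i p"
  using assms mem_level_set_iff[of u i 0 p] mem_level_set_iff[of v i n p] by (auto simp: walks_def)

text \<open>The level determines the position in \<open>p\<close>, so the \<open>THE\<close> in
  \<open>chain_word\<close> has exactly one candidate on each level.\<close>

lemma chain_word_level_set:
  assumes "length p = Suc n"
  shows "chain_word i (i + int n) (level_set i p) = p"
proof (rule nth_equalityI)
  show "length (chain_word i (i + int n) (level_set i p)) = length p"
    using assms by (simp add: chain_word_def)
next
  fix k assume "k < length (chain_word i (i + int n) (level_set i p))"
  then have "k < Suc n" by (simp add: chain_word_def)
  then show "chain_word i (i + int n) (level_set i p) ! k = p ! k"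
    using assms by (simp add: chain_word_def mem_level_set_iff)
qed

lemma finite_level_set: "finite (level_set i p)"
  by (simp add: level_set_def)

lemma card_level_set: "card (level_set i p) = length p"
proof -
  have "level_set i p = (\<lambda>k. (p ! k, i + int k)) ` {..<length p}"
    by (auto simp: level_set_def)
  moreover have "inj_on (\<lambda>k. (p ! k, i + int k)) {..<length p}"
    by (auto simp: inj_on_def)
  ultimately show ?thesis by (simp add: card_image)
qed


section \<open>Chains in intervals of a level poset\<close>

lemma chain_iff:
  "pred_on.chain A R C \<longleftrightarrow> C \<subseteq> A \<and> (\<forall>x\<in>C. \<forall>y\<in>C. x = y \<or> R x y \<or> R y x)"
  by (auto simp: pred_on.chain_def)

text \<open>Induction by level: the added element has maximal level, so the rest of the chain lies
  below it and, by induction with this element as the new top, on a walk ending there. A walk from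
  it to the old top is glued on. Hence \<open>v\<close> and \<open>j\<close> must vary.\<close>

lemma chain_subset_level_set:
  assumes "finite C"
    and "\<And>x y. x \<in> C \<Longrightarrow> y \<in> C \<Longrightarrow> x = y \<or> level_less G x y \<or> level_less G y x"
    and "\<And>x. x \<in> C \<Longrightarrow> level_less G (u, i) x"
    and "\<And>x. x \<in> C \<Longrightarrow> level_less G x (v, j)"
    and "level_less G (u, i) (v, j)"
  shows "\<exists>n. j = i + int n \<and> (\<exists>p\<in>walks G u v n. C \<subseteq> level_set i p)"
  using assms
proof (induction C arbitrary: v j rule: finite_ranking_induct[where f = snd])
  case empty
  then show ?case by (auto simp: level_less_iff_walks)
next
  case (insert x S)
  obtain w l where x: "x = (w, l)" by (cases x)
  show ?case
  proof (cases "x \<in> S")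
    case True
    then show ?thesis using insert by (simp add: insert_absorb)
  next
    case False
    \<comment> \<open>\<open>x\<close> and \<open>y\<close> are comparable, and \<open>x\<close>
      below \<open>y\<close> would contradict the maximal level of \<open>x\<close>.\<close>
    then have less: "level_less G y (w, l)" if "y \<in> S" for y
      using that insert.hyps(2)[of y] insert.prems(1)[of x y] x by (auto simp: level_less_def)
    have "\<exists>n. l = i + int n \<and> (\<exists>p\<in>walks G u w n. S \<subseteq> level_set i p)"
    proof (rule insert.IH)
      show "y = z \<or> level_less G y z \<or> level_less G z y" if "y \<in> S" "z \<in> S" for y z
        using insert.prems(1) that by blast
      show "level_less G (u, i) y" if "y \<in> S" for y using insert.prems(2) that by blast
      show "level_less G y (w, l)" if "y \<in> S" for y using less that .
      show "level_less G (u, i) (w, l)" using insert.prems(2) x by blast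
    qed
    then obtain n p where p: "l = i + int n" "p \<in> walks G u w n" "S \<subseteq> level_set i p"
      by blast
    have "level_less G (w, l) (v, j)" using insert.prems x by blast
    then obtain m q where q: "j = l + int m" "q \<in> walks G w v m"
      by (auto simp: level_less_iff_walks)
    have "insert x S \<subseteq> level_set i (p @ tl q)"
      using walks_append(2)[OF p(2) q(2), of i] level_set_walk_ends(2)[OF p(2), of i] p x by auto
    moreover have "p @ tl q \<in> walks G u v (n + m)" using walks_append(1)[OF p(2) q(2)] .
    ultimately show ?thesis using p(1) q(1) by (intro exI[of _ "n + m"]) auto
  qed
qed

section \<open>Maximal chains and order complex of one interval\<close>

context
  fixes G :: "('a, 'b) pre_digraph" and u v :: 'a and i :: int and n :: nat
  assumes fin: "finite (verts G)" and n_pos: "0 < n" and walk_ex: "walks G u v n \<noteq> {}"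
begin

private abbreviation "Q \<equiv> interval (level_less G) (u, i) (v, i + int n)"

lemma level_set_chain:
  assumes "p \<in> walks G u v n"
  shows "pred_on.chain Q (level_less G) (level_set i p)"
proof -
  have nth: "p ! 0 = u" "p ! n = v" "length p = Suc n" using assms by (auto simp: walks_def)
  have "(p ! k, i + int k) \<in> Q" if "k \<le> n" for k
    using level_less_nth[OF assms, of 0 k i] level_less_nth[OF assms, of k n i] that nth
    by (cases "k = 0"; cases "k = n") (auto simp: interval_def)
  then have "level_set i p \<subseteq> Q" using nth by (auto simp: level_set_def)
  moreover have "x = y \<or> level_less G x y \<or> level_less G y x"
    if xy: "x \<in> level_set i p" "y \<in> level_set i p" for x y
  proof -
    obtain a b where "x = (p ! a, i + int a)" "y = (p ! b, i + int b)" "a \<le> n" "b \<le> n"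
      using xy nth by (auto simp: level_set_def)
    then show ?thesis
      using level_less_nth[OF assms, of a b i] level_less_nth[OF assms, of b a i]
      by (cases a b rule: linorder_cases) auto
  qed
  ultimately show ?thesis unfolding chain_iff by blast
qed

text \<open>Makes chains finite, as the induction over them requires. \<open>interval\<close> has no
  carrier, so that first components are vertices is read off the walks behind
  \<open>level_less\<close>.\<close>

lemma finite_interval: "finite Q"
proof (rule finite_subset)
  obtain p where p: "p \<in> walks G u v n" using walk_ex by blast
  then have "p ! 0 \<in> verts G" "p ! n \<in> verts G"
    unfolding walks_def vwalk_def using nth_mem[of 0 p] nth_mem[of n p] by auto
  then have verts: "u \<in> verts G" "v \<in> verts G" using walks_nth[OF p] by auto
  show "Q \<subseteq> verts G \<times> {i..i + int n}"
  proof
    fix x assume "x \<in> Q"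
    moreover have "fst x \<in> verts G" if "level_less G (u, i) x"
      using that unfolding level_less_def vwalk_def by (metis last_in_set subsetD)
    ultimately show "x \<in> verts G \<times> {i..i + int n}"
      using verts by (cases x) (auto simp: interval_def level_less_def)
  qed
  show "finite (verts G \<times> {i..i + int n})" using fin by simp
qed

text \<open>\<open>chain_subset_level_set\<close> needs strict comparisons with both ends, so the
  ends are removed first; they can be put back because the level set of every walk from
  \<open>u\<close> to \<open>v\<close> contains them.\<close>

lemma chain_interval_subset_level_set:
  assumes "pred_on.chain Q (level_less G) C"
  shows "\<exists>p\<in>walks G u v n. C \<subseteq> level_set i p"
proof -
  let ?D = "C - {(u, i), (v, i + int n)}"
  have CQ: "C \<subseteq> Q" using assms by (simp add: pred_on.chain_def)
  have "\<exists>m. i + int n = i + int m \<and> (\<exists>p\<in>walks G u v m. ?D \<subseteq> level_set i p)"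
  proof (rule chain_subset_level_set)
    show "finite ?D" using CQ finite_interval by (meson finite_Diff finite_subset)
    show "x = y \<or> level_less G x y \<or> level_less G y x" if "x \<in> ?D" "y \<in> ?D" for x y
      using assms that by (auto simp: pred_on.chain_def)
    show "level_less G (u, i) x" "level_less G x (v, i + int n)" if "x \<in> ?D" for x
      using that CQ by (auto simp: interval_def)
    show "level_less G (u, i) (v, i + int n)" using n_pos walk_ex by (auto simp: level_less_iff_walks)
  qed
  then show ?thesis using level_set_walk_ends by fastforce
qed

text \<open>Every chain lies in the level set of a walk, and these all have \<open>n + 1\<close>
  elements, so none is properly contained in another.\<close>

lemma maximal_chains_interval: "maximal_chains Q (level_less G) = level_set i ` walks G u v n"
proof -
  have "pred_on.maxchain Q (level_less G) (level_set i p)" if p: "p \<in> walks G u v n" for p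
  proof -
    have False if S: "pred_on.chain Q (level_less G) S" "level_set i p \<subset> S" for S
    proof -
      obtain q where q: "q \<in> walks G u v n" "S \<subseteq> level_set i q"
        using chain_interval_subset_level_set[OF S(1)] by blast
      then have "level_set i p \<subset> level_set i q" using S(2) by blast
      then have "card (level_set i p) < card (level_set i q)"
        by (simp add: psubset_card_mono finite_level_set)
      then show False using p q by (simp add: card_level_set walks_length)
    qed
    then show ?thesis using level_set_chain[OF p] by (auto simp: pred_on.maxchain_def)
  qed
  moreover have "C \<in> level_set i ` walks G u v n" if "pred_on.maxchain Q (level_less G) C" for C
  proof -
    have "pred_on.chain Q (level_less G) C" using that by (simp add: pred_on.maxchain_def)
    then obtain p where "p \<in> walks G u v n" "C \<subseteq> level_set i p"
      using chain_interval_subset_level_set by blast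
    then show ?thesis using that level_set_chain[of p] by (auto simp: pred_on.maxchain_def)
  qed
  ultimately show ?thesis by (auto simp: maximal_chains_def)
qed

lemma order_complex_interval:
  "order_complex Q (level_less G) (u, i) (v, i + int n) =
    {C. \<exists>p\<in>walks G u v n. C \<subseteq> level_set i p - {(u, i), (v, i + int n)}}"
proof -
  let ?B = "{(u, i), (v, i + int n)}"
  have "pred_on.chain (Q - ?B) (level_less G) C \<longleftrightarrow>
      (\<exists>p\<in>walks G u v n. C \<subseteq> level_set i p - ?B)" for C
  proof
    assume C: "pred_on.chain (Q - ?B) (level_less G) C"
    then have "pred_on.chain Q (level_less G) C" unfolding chain_iff by blast
    then obtain p where "p \<in> walks G u v n" "C \<subseteq> level_set i p"
      using chain_interval_subset_level_set by blast
    moreover have "C \<inter> ?B = {}" using C unfolding chain_iff by blast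
    ultimately show "\<exists>p\<in>walks G u v n. C \<subseteq> level_set i p - ?B" by blast
  next
    assume "\<exists>p\<in>walks G u v n. C \<subseteq> level_set i p - ?B"
    then obtain p where p: "p \<in> walks G u v n" "C \<subseteq> level_set i p - ?B" by blast
    show "pred_on.chain (Q - ?B) (level_less G) C"
      using level_set_chain[OF p(1)] p(2) unfolding chain_iff by blast
  qed
  then show ?thesis unfolding order_complex_def by (rule Collect_cong)
qed

end

lemma finite_walks:
  assumes "finite (verts G)"
  shows "finite (walks G u v n)"
proof (rule finite_subset)
  show "walks G u v n \<subseteq> {p. set p \<subseteq> verts G \<and> length p = Suc n}"
    by (auto simp: walks_def vwalk_def)
  show "finite {p. set p \<subseteq> verts G \<and> length p = Suc n}"
    using assms by (rule finite_lists_length_eq)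
qed


section \<open>Lexicographic exchange of walks\<close>

text \<open>The vertex shelling property is applied to the segment between the last common vertex
  before the first difference of the two walks and the first common vertex after it, so the
  replaced vertex \<open>p ! m\<close> lies on a level where the walks differ.\<close>
lemma walk_exchange:
  assumes vso: "vertex_shelling_order G lt"
    and p: "p \<in> walks G u v n" and p': "p' \<in> walks G u v n" and lex: "(p', p) \<in> lexord lt"
  obtains m w where "0 < m" "m < n" "p[m := w] \<in> walks G u v n" "(p[m := w], p) \<in> lexord lt"
    "p' ! m \<noteq> p ! m"
proof -
  have irr: "(x, x) \<notin> lt" for x
    using vso by (auto simp: vertex_shelling_order_def strict_linear_order_on_def irrefl_def)
  have len: "length p = Suc n" "length p' = Suc n" using p p' by (auto simp: walks_def)
  \<comment> \<open>Equal lengths exclude a proper prefix, so \<open>a\<close> is the first position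
    where the walks differ.\<close>
  then obtain a where a: "a \<le> n" "take a p' = take a p" "(p' ! a, p ! a) \<in> lt"
    using lex by (auto simp: lexord_take_index_conv less_Suc_eq_le)
  have pre: "p' ! k = p ! k" if "k < a" for k using a(2) that by (metis nth_take)
  have "a \<noteq> 0" "a \<noteq> n" using a(3) irr p p' by (metis walks_nth)+
  then have "a > 0" "a < n" using a(1) by auto
  \<comment> \<open>The walks meet again after \<open>a\<close>, at the latest in \<open>v\<close>
    at position \<open>n\<close>.\<close>
  define b where "b = (LEAST b. a < b \<and> p' ! b = p ! b)"
  have n_ok: "a < n \<and> p' ! n = p ! n" using p p' \<open>a < n\<close> by (simp add: walks_def)
  then have b: "a < b" "p' ! b = p ! b" and "b \<le> n"
    unfolding b_def by (rule LeastI2, simp, rule LeastI2, simp, rule Least_le)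
  have differ: "p' ! k \<noteq> p ! k" if "a \<le> k" "k < b" for k
  proof (cases "k = a")
    case True
    then show ?thesis using a(3) irr by metis
  next
    case False
    then show ?thesis using that not_less_Least[of k "\<lambda>b. a < b \<and> p' ! b = p ! b"] by (auto simp: b_def)
  qed
  \<comment> \<open>The last common position before \<open>a\<close>. In the segments from
    \<open>s\<close> to \<open>b\<close>, position 1 is position \<open>a\<close> of the walks,
    where the vertex shelling order compares them.\<close>
  define s where "s = a - 1"
  have s: "a = Suc s" "s \<le> b" using \<open>a > 0\<close> \<open>a < b\<close> by (auto simp: s_def)
  let ?q = "take (Suc (b - s)) (drop s p)" and ?q' = "take (Suc (b - s)) (drop s p')"
  have q: "?q \<in> walks G (p ! s) (p ! b) (b - s)"
    using walks_take_drop[OF p s(2) \<open>b \<le> n\<close>] .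
  have q': "?q' \<in> walks G (p ! s) (p ! b) (b - s)"
    using walks_take_drop[OF p' s(2) \<open>b \<le> n\<close>] pre[of s] s b by simp
  have nth: "?q ! k = p ! (s + k)" "?q' ! k = p' ! (s + k)" if "k \<le> b - s" for k
    using that len \<open>b \<le> n\<close> s by auto
  have "1 \<le> b - s" using s \<open>a < b\<close> by simp
  moreover have "(?q' ! 1, ?q ! 1) \<in> lt" using nth[of 1] a(3) s \<open>a < b\<close> by simp
  ultimately have "vwalk ?q G \<and> vwalk ?q' G \<and> hd ?q = hd ?q' \<and> last ?q = last ?q' \<and>
      vwalk_length ?q = b - s \<and> vwalk_length ?q' = b - s \<and> 1 \<le> b - s \<and> (?q' ! 1, ?q ! 1) \<in> lt"
    using q q' unfolding walks_hd_last mem_Collect_eq vwalk_length_simp by presburger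
  then obtain t w where t: "1 \<le> t" "t \<le> b - s - 1" and w: "w \<in> verts G" "(w, ?q ! t) \<in> lt"
      "?q ! (t - 1) \<rightarrow>\<^bsub>G\<^esub> w" "w \<rightarrow>\<^bsub>G\<^esub> ?q ! (t + 1)"
    using vso unfolding vertex_shelling_order_def by blast
  \<comment> \<open>Translates the position \<open>t\<close> inside the segment to one in
    \<open>p\<close>; the bounds on \<open>t\<close> give \<open>a \<le> m < b\<close>.\<close>
  define m where "m = s + t"
  have m: "0 < m" "m < n" "a \<le> m" "m < b" using t s \<open>a < b\<close> \<open>b \<le> n\<close> by (auto simp: m_def)
  have "s + (t - 1) = m - 1" "s + (t + 1) = Suc m" using t by (auto simp: m_def)
  then have wm: "(w, p ! m) \<in> lt" "p ! (m - 1) \<rightarrow>\<^bsub>G\<^esub> w" "w \<rightarrow>\<^bsub>G\<^esub> p ! Suc m"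
    using w nth(1)[of t] nth(1)[of "t - 1"] nth(1)[of "t + 1"] t m by (auto simp: m_def)
  have "p[m := w] \<in> walks G u v n" using walks_list_update[OF p m(1,2) w(1) wm(2,3)] .
  moreover have "(p[m := w], p) \<in> lexord lt"
    unfolding lexord_take_index_conv using wm(1) len m by (intro disjI2 exI[of _ m]) auto
  ultimately show thesis using that m differ by blast
qed

section \<open>The lexicographic shelling of an interval\<close>

theorem theorem6p2:
  fixes G :: "('a, 'b) pre_digraph" and lt :: "'a rel" and u v :: 'a and i j :: int
  assumes "fin_digraph G" and "nomulti_digraph G" and "verts G \<noteq> {}"
    and "vertex_shelling_order G lt"
    and "level_less G (u, i) (v, j)"
  shows "let Q = interval (level_less G) (u, i) (v, j);
             M = maximal_chains Q (level_less G)
         in (\<exists>!Cs. lex_ordering lt i j M Cs) \<and>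
            (\<forall>Cs. lex_ordering lt i j M Cs \<longrightarrow>
               shelling (order_complex Q (level_less G) (u, i) (v, j))
                 (map (\<lambda>C. C - {(u, i), (v, j)}) Cs))"
proof -
  obtain n where n: "n > 0" "j = i + int n" "walks G u v n \<noteq> {}"
    using assms(5) by (auto simp: level_less_iff_walks)
  have fin: "finite (verts G)" using assms(1) by (rule fin_digraph.finite_verts)
  have lt: "trans lt" "irrefl lt" "total_on (verts G) lt"
    using assms(4) by (auto simp: vertex_shelling_order_def strict_linear_order_on_def)
  define Q where "Q = interval (level_less G) (u, i) (v, j)"
  define M where "M = maximal_chains Q (level_less G)"
  define R where "R = (\<lambda>C D. (chain_word i j C, chain_word i j D) \<in> lexord lt)"
  have M: "M = level_set i ` walks G u v n"
    unfolding M_def Q_def n(2) using maximal_chains_interval[OF fin n(1,3)] .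
  have word: "chain_word i j (level_set i p) = p" if "p \<in> walks G u v n" for p
    using that chain_word_level_set[of p n i] by (simp add: n(2) walks_length)
  have irrefl: "\<not> R C C" for C
    using lexord_irrefl[OF lt(2)] by (simp add: R_def irrefl_def)
  have "\<exists>!Cs. set Cs = M \<and> sorted_wrt R Cs"
  proof (rule ex1_sorted_wrt_enumeration)
    show "finite M" using finite_walks[OF fin] M by simp
    show "R x z" if "R x y" "R y z" for x y z
      using that lexord_trans[OF _ _ lt(1)] unfolding R_def by blast
    show "\<not> R x x" for x by (rule irrefl)
    show "R x y \<or> R y x" if xy: "x \<in> M" "y \<in> M" "x \<noteq> y" for x y
    proof -
      obtain p q where "x = level_set i p" "p \<in> walks G u v n" "y = level_set i q" "q \<in> walks G u v n"
        using xy M by blast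
      then show ?thesis
        using xy(3) lexord_total_on_eq_length[OF _ lt(3), of p q] word
        by (auto simp: R_def walks_def vwalk_def)
    qed
  qed
  moreover have "shelling (order_complex Q (level_less G) (u, i) (v, j))
      (map (\<lambda>C. C - {(u, i), (v, j)}) Cs)" if Cs: "set Cs = M" "sorted_wrt R Cs" for Cs
  proof (rule shellingI_exchange)
    let ?B = "{(u, i), (v, j)}"
    have ends: "?B \<subseteq> C" if "C \<in> M" for C
      using that level_set_walk_ends by (auto simp: M n(2))
    show "order_complex Q (level_less G) (u, i) (v, j) =
        {F. \<exists>E\<in>set (map (\<lambda>C. C - ?B) Cs). F \<subseteq> E}"
      using order_complex_interval[OF fin n(1,3), of i] unfolding Q_def n(2)
      by (simp add: Cs(1) M)
    show "map (\<lambda>C. C - ?B) Cs \<noteq> []" using Cs(1) M n(3) by auto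
    \<comment> \<open>Every maximal chain contains both ends, so it is recovered by adding them
      back.\<close>
    have "inj_on (\<lambda>C. C - ?B) (set Cs)"
      using ends unfolding Cs(1) inj_on_def by (metis Un_Diff_cancel2 Un_absorb2)
    moreover have "distinct Cs"
      using sorted_wrt_irrefl_distinct[OF Cs(2)] irrefl by blast
    ultimately show "distinct (map (\<lambda>C. C - ?B) Cs)" by (simp add: distinct_map)
    show "finite E" if "E \<in> set (map (\<lambda>C. C - ?B) Cs)" for E
      using that by (auto simp: Cs(1) M finite_level_set)
    show "card E = n - 1" if E: "E \<in> set (map (\<lambda>C. C - ?B) Cs)" for E
    proof -
      obtain p where p: "p \<in> walks G u v n" "E = level_set i p - ?B" using E Cs(1) M by auto
      \<comment> \<open>Positive \<open>n\<close> puts the ends on different levels, which leaves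
        \<open>n + 1 - 2\<close> elements.\<close>
      moreover have "card ?B = 2" using n by simp
      ultimately show ?thesis
        using ends[of "level_set i p"] M
        by (simp add: card_Diff_subset card_level_set walks_length)
    qed
    fix h k assume hk: "h < k" "k < length (map (\<lambda>C. C - ?B) Cs)"
    then have "Cs ! h \<in> M" "Cs ! k \<in> M" unfolding Cs(1)[symmetric] by simp_all
    then obtain p' p where p': "p' \<in> walks G u v n" "Cs ! h = level_set i p'"
      and p: "p \<in> walks G u v n" "Cs ! k = level_set i p"
      unfolding M by blast
    have "R (Cs ! h) (Cs ! k)" using Cs(2) hk sorted_wrt_nth_less by fastforce
    then have "(p', p) \<in> lexord lt" using p p' word by (simp add: R_def)
    then obtain m w where m: "0 < m" "m < n" and r: "p[m := w] \<in> walks G u v n"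
        "(p[m := w], p) \<in> lexord lt" and differ: "p' ! m \<noteq> p ! m"
      using walk_exchange[OF assms(4) p(1) p'(1)] by blast
    let ?x = "(p ! m, i + int m)" and ?r = "level_set i (p[m := w])"
    have "?r \<in> set Cs" using r(1) Cs(1) M by blast
    then obtain l where l: "l < length Cs" "Cs ! l = ?r" by (meson in_set_conv_nth)
    have "R (Cs ! l) (Cs ! k)" using r p l word by (simp add: R_def)
    \<comment> \<open>The chain \<open>?r\<close> has some position \<open>l\<close> in the list;
      \<open>k < l\<close> would give \<open>R (Cs ! k) (Cs ! l)\<close> by sortedness, and
      \<open>k = l\<close> violates irreflexivity.\<close>
    moreover have "\<not> R (Cs ! k) (Cs ! l)"
      using \<open>R (Cs ! l) (Cs ! k)\<close> irrefl[of "Cs ! k"] lexord_trans[OF _ _ lt(1)] unfolding R_def by blast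
    ultimately have "l < k"
      using sorted_wrt_nth_less[OF Cs(2), of k l] irrefl l by (metis linorder_neqE_nat)
    moreover have "?x \<in> Cs ! k - ?B"
      using m p by (simp add: mem_level_set_iff walks_length n(2))
    moreover have "Cs ! k - ?B - {?x} \<subseteq> Cs ! l - ?B"
    proof
      fix y assume y: "y \<in> Cs ! k - ?B - {?x}"
      then obtain a where "y = (p ! a, i + int a)" "a < length p" "a \<noteq> m"
        unfolding p(2) by (auto simp: level_set_def)
      then have "y \<in> Cs ! l" unfolding l(2) by (simp add: mem_level_set_iff)
      then show "y \<in> Cs ! l - ?B" using y by blast
    qed
    \<comment> \<open>On level \<open>i + m\<close> the chain of \<open>p'\<close> has only the
      vertex \<open>p' ! m\<close>, which differs from \<open>p ! m\<close>.\<close>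
    moreover have "?x \<notin> Cs ! h - ?B"
      using differ p' by (simp add: mem_level_set_iff)
    ultimately show "\<exists>l<k. \<exists>x\<in>map (\<lambda>C. C - ?B) Cs ! k.
        map (\<lambda>C. C - ?B) Cs ! k - {x} \<subseteq> map (\<lambda>C. C - ?B) Cs ! l \<and> x \<notin> map (\<lambda>C. C - ?B) Cs ! h"
      using hk l(1) by (intro exI[of _ l] conjI bexI[of _ ?x]) auto
  qed
  ultimately show ?thesis
    unfolding Let_def lex_ordering_def M_def[symmetric] Q_def[symmetric] R_def[symmetric]
    by blast
qed

end
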